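(* Let $n\ge 1$ and let $\xi_n$ be the probability measure on $\mathbb{R}^n$ which is the product of $n$ copies of the probability measure $\xi$ on $\mathbb{R}$ with density $\tfrac12 e^{-|x|}$. Let $B_2=\{x\in\mathbb{R}^n:\sum_i x_i^2\le 1\}$ and $B_1=\{x\in\mathbb{R}^n:\sum_i|x_i|\le 1\}$ be the unit balls of $\ell_2^n$ and $\ell_1^n$. Then for every measurable subset $A$ of $\mathbb{R}^n$ and every $t>0$, $$\xi_n\{x:\; x\notin A+6\sqrt{t}\,B_2+9t\,B_1\}\le \xi_n(A)^{-1}e^{-t}$$ (with $\xi_n(A)^{-1}=+\infty$ if $\xi_n(A)=0$).
   Context: Here $A+B=\{a+b: a\in A, b\in B\}$ denotes the Minkowski sum, and "measurable" means Borel measurable (measures of Minkowski sums are taken in the sense of the completion). *)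

theory Defs
  imports "HOL-Probability.Probability" "HOL-Library.Set_Algebras"
begin

definition xi :: "real measure" where
  "xi = density lborel (\<lambda>x. ennreal (exp (- \<bar>x\<bar>) / 2))"

(* The library's finite product measure lives on functions 'n \<Rightarrow> real; it is transported
   along the identification f \<mapsto> (\<chi> i. f i) with vectors. *)
definition xi_n :: "(real ^ 'n) measure" where
  "xi_n = distr (\<Pi>\<^sub>M i\<in>(UNIV :: 'n set). xi) borel (\<lambda>f. \<chi> i. f i)"

definition B1 :: "(real ^ 'n) set" where
  "B1 = {x. (\<Sum>i\<in>UNIV. \<bar>x $ i\<bar>) \<le> 1}"

definition B2 :: "(real ^ 'n) set" where
  "B2 = {x. (\<Sum>i\<in>UNIV. (x $ i)\<^sup>2) \<le> 1}"

lemma sets_xi [simp, measurable_cong]: "sets xi = sets borel"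
  by (simp add: xi_def)

lemma space_xi [simp]: "space xi = UNIV"
  by (simp add: xi_def)

lemma sets_xi_n [simp, measurable_cong]: "sets xi_n = sets borel"
  by (simp add: xi_n_def)

lemma space_xi_n [simp]: "space xi_n = UNIV"
  by (simp add: xi_n_def)

lemma prob_space_xi: "prob_space xi"
proof
  let ?f = "\<lambda>x. ennreal (exponential_density 1 x)"
  interpret E: prob_space "density lborel ?f"
    by (rule prob_space_exponential_density) simp
  have I: "(\<integral>\<^sup>+x. ?f x \<partial>lborel) = 1"
    using E.emeasure_space_1 by (simp add: emeasure_density)
  have J: "(\<integral>\<^sup>+x. ?f (- x) \<partial>lborel) = 1"
    using nn_integral_real_affine[of ?f "-1" 0] I by simp
  have ae: "AE x in lborel. 2 * ennreal (exp (- \<bar>x\<bar>) / 2) = ?f x + ?f (- x)"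
    using AE_lborel_singleton[of "0::real"]
  proof eventually_elim
    case (elim x)
    have "2 * ennreal (exp (- \<bar>x\<bar>) / 2) = ennreal (2 * (exp (- \<bar>x\<bar>) / 2))"
      by (subst ennreal_mult) simp_all
    moreover have "ennreal (2 * (exp (- \<bar>x\<bar>) / 2)) = ?f x + ?f (- x)"
    proof (cases "x < 0")
      case True
      then show ?thesis by (simp add: exponential_density_def)
    next
      case False
      with elim have "x > 0" by simp
      then show ?thesis by (simp add: exponential_density_def)
    qed
    ultimately show ?case by simp
  qed
  have "2 * emeasure xi (space xi) = (\<integral>\<^sup>+x. 2 * ennreal (exp (- \<bar>x\<bar>) / 2) \<partial>lborel)"
    by (simp add: xi_def emeasure_density nn_integral_cmult[symmetric])
  also have "\<dots> = (\<integral>\<^sup>+x. ?f x + ?f (- x) \<partial>lborel)"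
    by (rule nn_integral_cong_AE[OF ae])
  also have "\<dots> = 2 * 1"
    by (subst nn_integral_add) (simp_all add: I J)
  finally have "2 * emeasure xi (space xi) = 2 * 1" .
  then show "emeasure xi (space xi) = 1"
    using ennreal_mult_cancel_left[of 2 "emeasure xi (space xi)" 1] by simp
qed

lemma measurable_vec_lambda_PiM:
  "(\<lambda>f. \<chi> i. f i) \<in> (\<Pi>\<^sub>M i\<in>(UNIV :: 'n::finite set). xi) \<rightarrow>\<^sub>M (borel :: (real ^ 'n) measure)"
proof -
  have "(\<lambda>f. (\<chi> i. f i) \<bullet> axis j 1) \<in> borel_measurable (\<Pi>\<^sub>M i\<in>(UNIV :: 'n set). xi)" for j
  proof -
    have "(\<lambda>f. f j) \<in> (\<Pi>\<^sub>M i\<in>(UNIV :: 'n set). xi) \<rightarrow>\<^sub>M xi"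
      by (rule measurable_component_singleton) simp
    then show ?thesis
      by (simp add: inner_axis measurable_cong_sets[OF refl sets_xi])
  qed
  then have "(\<lambda>f. (\<chi> i. f i) \<bullet> b) \<in> borel_measurable (\<Pi>\<^sub>M i\<in>(UNIV :: 'n set). xi)"
    if "b \<in> Basis" for b :: "real ^ 'n"
    using that unfolding Basis_vec_def Basis_real_def by blast
  then show ?thesis
    by (subst borel_measurable_euclidean_space) blast
qed

lemma product_prob_space_xi: "product_prob_space (\<lambda>_. xi)"
  by (rule product_prob_spaceI) (rule prob_space_xi)

lemma prob_space_xi_n: "prob_space (xi_n :: (real ^ 'n) measure)"
proof -
  interpret product_prob_space "\<lambda>_. xi" "UNIV :: 'n set"
    by (rule product_prob_space_xi)
  show ?thesis
    unfolding xi_n_def by (rule prob_space_distr[OF measurable_vec_lambda_PiM])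
qed

lemma emeasure_xi_n_box:
  fixes S :: "'n::finite \<Rightarrow> real set"
  assumes S: "\<And>i. S i \<in> sets borel"
  shows "emeasure xi_n {x :: real ^ 'n. \<forall>i. x $ i \<in> S i} = (\<Prod>i\<in>UNIV. emeasure xi (S i))"
proof -
  interpret product_prob_space "\<lambda>_. xi" "UNIV :: 'n set"
    by (rule product_prob_space_xi)
  have "{x :: real ^ 'n. \<forall>i. x $ i \<in> S i} = (\<Inter>i. (\<lambda>x. x $ i) -` S i \<inter> space borel)"
    by auto
  also have "\<dots> \<in> sets borel"
  proof (rule sets.finite_INT)
    show "(\<lambda>x :: real ^ 'n. x $ i) -` S i \<inter> space borel \<in> sets borel" for i
      by (rule measurable_sets[OF borel_measurable_nth S])
  qed simp_all
  finally have "emeasure xi_n {x :: real ^ 'n. \<forall>i. x $ i \<in> S i}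
      = emeasure (\<Pi>\<^sub>M i\<in>(UNIV :: 'n set). xi) (Pi\<^sub>E UNIV S)"
    unfolding xi_n_def
    by (subst emeasure_distr[OF measurable_vec_lambda_PiM])
      (auto simp: space_PiM PiE_UNIV_domain intro!: arg_cong2[where f = emeasure])
  also have "\<dots> = (\<Prod>i\<in>UNIV. emeasure xi (S i))"
    by (rule emeasure_PiM) (simp_all add: S)
  finally show ?thesis .
qed

end

theory Submission
  imports Defs
begin

text \<open>
  Maurey's property (\<open>\<tau>\<close>): \<open>H x * F y \<le> exp (w x y)\<close> for all \<open>x\<close>, \<open>y\<close> forces
  \<open>(\<integral>H) * (\<integral>F) \<le> 1\<close>. It tensorizes by Fubini and passes to images. For the one-sided
  exponential measure it is proved by transporting \<open>H x * exp (- x)\<close> to \<open>F y * exp (- y)\<close> by a monotone map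
  \<open>T\<close> and applying the change of variables \<open>z = (x + T x) / 2 - w (x - T x)\<close> in \<open>\<integral>exp (- z) dz \<le> 1\<close>.
  Since \<open>xi\<close> is the law of the difference of two independent exponential variables, it inherits the
  property with the cost \<open>2 * w (s / 2)\<close>, and so does \<open>xi_n\<close> with the sum of these costs. A point of total
  cost at most \<open>t\<close> splits into its small coordinates, in \<open>6 * sqrt t * B2\<close>, and its large ones, in
  \<open>9 * t * B1\<close>, so \<open>F\<close> the indicator of \<open>A\<close> and \<open>H\<close> a multiple of the indicator of a set
  outside the enlargement give the bound.

  The enlargement of \<open>A\<close> need not be Borel. It lies between an open set and a closed one whose
  difference is null: a boundary point enters the open set when one suitable coordinate is moved,
  so along that coordinate the boundary is countable.
\<close>

section \<open>Property (\<open>\<tau>\<close>)\<close>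

text \<open>
  Maurey states this for \<open>F = exp (- f)\<close> and \<open>H\<close> the exponential of the infimum convolution of
  \<open>f\<close> and \<open>w\<close>. Allowing any smaller measurable \<open>H\<close> avoids the measurability of the
  infimum convolution.
\<close>

definition property_tau :: "'a measure \<Rightarrow> ('a \<Rightarrow> 'a \<Rightarrow> real) \<Rightarrow> bool" where
  "property_tau M w \<longleftrightarrow>
    (\<forall>H\<in>borel_measurable M. \<forall>F\<in>borel_measurable M.
      (\<forall>x\<in>space M. \<forall>y\<in>space M. H x * F y \<le> ennreal (exp (w x y))) \<longrightarrow>
      (\<integral>\<^sup>+x. H x \<partial>M) * (\<integral>\<^sup>+y. F y \<partial>M) \<le> 1)"

lemma property_tauI:
  assumes "\<And>H F. \<lbrakk>H \<in> borel_measurable M; F \<in> borel_measurable M;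
      \<And>x y. x \<in> space M \<Longrightarrow> y \<in> space M \<Longrightarrow> H x * F y \<le> ennreal (exp (w x y))\<rbrakk>
    \<Longrightarrow> (\<integral>\<^sup>+x. H x \<partial>M) * (\<integral>\<^sup>+y. F y \<partial>M) \<le> 1"
  shows "property_tau M w"
  using assms unfolding property_tau_def by blast

lemma property_tauD:
  assumes "property_tau M w" "H \<in> borel_measurable M" "F \<in> borel_measurable M"
    and "\<And>x y. x \<in> space M \<Longrightarrow> y \<in> space M \<Longrightarrow> H x * F y \<le> ennreal (exp (w x y))"
  shows "(\<integral>\<^sup>+x. H x \<partial>M) * (\<integral>\<^sup>+y. F y \<partial>M) \<le> 1"
  using assms unfolding property_tau_def by blast

text \<open>The factor \<open>ennreal (exp (- a))\<close> is invertible, so a cost can change sides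
  even when \<open>c\<close> is infinite.\<close>

lemma ennreal_mult_exp_le_iff:
  "c * ennreal (exp (- a)) \<le> ennreal (exp b) \<longleftrightarrow> c \<le> ennreal (exp (a + b))"
proof
  have e: "c * ennreal (exp (- a)) * ennreal (exp a) = c"
    by (simp add: mult.assoc flip: ennreal_mult exp_add)
  assume "c * ennreal (exp (- a)) \<le> ennreal (exp b)"
  then have "c * ennreal (exp (- a)) * ennreal (exp a) \<le> ennreal (exp b) * ennreal (exp a)"
    by (rule mult_right_mono) simp
  then show "c \<le> ennreal (exp (a + b))"
    unfolding e by (simp add: exp_add mult.commute flip: ennreal_mult)
next
  assume "c \<le> ennreal (exp (a + b))"
  then have "c * ennreal (exp (- a)) \<le> ennreal (exp (a + b)) * ennreal (exp (- a))"
    by (rule mult_right_mono) simp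
  then show "c * ennreal (exp (- a)) \<le> ennreal (exp b)"
    by (simp flip: ennreal_mult exp_add)
qed

text \<open>Fubini: for fixed first coordinates the sections, one of them scaled by
  \<open>exp (- w x x')\<close>, satisfy the constraint of \<open>v\<close>. The resulting bound is
  the constraint of \<open>w\<close> for the inner integrals.\<close>

lemma property_tau_pair:
  fixes M :: "'a measure" and N :: "'b measure"
  assumes "sigma_finite_measure N"
    and M: "property_tau M w" and N: "property_tau N v"
  shows "property_tau (M \<Otimes>\<^sub>M N) (\<lambda>p q. w (fst p) (fst q) + v (snd p) (snd q))"
proof (rule property_tauI)
  interpret N: sigma_finite_measure N by fact
  fix H F :: "'a \<times> 'b \<Rightarrow> ennreal"
  assume [measurable]: "H \<in> borel_measurable (M \<Otimes>\<^sub>M N)" "F \<in> borel_measurable (M \<Otimes>\<^sub>M N)"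
    and HF: "\<And>p q. p \<in> space (M \<Otimes>\<^sub>M N) \<Longrightarrow> q \<in> space (M \<Otimes>\<^sub>M N) \<Longrightarrow>
      H p * F q \<le> ennreal (exp (w (fst p) (fst q) + v (snd p) (snd q)))"
  have "(\<integral>\<^sup>+x. \<integral>\<^sup>+y. H (x, y) \<partial>N \<partial>M) * (\<integral>\<^sup>+x. \<integral>\<^sup>+y. F (x, y) \<partial>N \<partial>M) \<le> 1"
  proof (rule property_tauD[OF M])
    fix x x' assume x [measurable]: "x \<in> space M" "x' \<in> space M"
    have "(\<integral>\<^sup>+y. H (x, y) * ennreal (exp (- w x x')) \<partial>N) * (\<integral>\<^sup>+y. F (x', y) \<partial>N) \<le> 1"
    proof (rule property_tauD[OF N])
      fix y y' assume "y \<in> space N" "y' \<in> space N"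
      then have "H (x, y) * F (x', y') \<le> ennreal (exp (w x x' + v y y'))"
        using HF[of "(x, y)" "(x', y')"] x by (simp add: space_pair_measure)
      then show "H (x, y) * ennreal (exp (- w x x')) * F (x', y') \<le> ennreal (exp (v y y'))"
        by (subst (asm) ennreal_mult_exp_le_iff[symmetric]) (simp add: mult_ac)
    qed measurable
    then have "(\<integral>\<^sup>+y. H (x, y) \<partial>N) * (\<integral>\<^sup>+y. F (x', y) \<partial>N) * ennreal (exp (- w x x')) \<le> ennreal (exp 0)"
      by (subst (asm) nn_integral_multc) (auto simp: mult_ac)
    then show "(\<integral>\<^sup>+y. H (x, y) \<partial>N) * (\<integral>\<^sup>+y. F (x', y) \<partial>N) \<le> ennreal (exp (w x x'))"
      by (simp only: ennreal_mult_exp_le_iff) simp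
  qed measurable
  then show "integral\<^sup>N (M \<Otimes>\<^sub>M N) H * integral\<^sup>N (M \<Otimes>\<^sub>M N) F \<le> 1"
    by (simp add: N.nn_integral_fst)
qed

text \<open>Composing \<open>H\<close> and \<open>F\<close> with \<open>f\<close> reduces the claim
  to \<open>M\<close>. The image cost has to lie below \<open>w\<close> on all pairs of preimages,
  so \<open>f\<close> may fail to be injective.\<close>

lemma property_tau_distr:
  fixes M :: "'a measure" and N :: "'b measure"
  assumes M: "property_tau M w" and f [measurable]: "f \<in> measurable M N"
    and wv: "\<And>x y. x \<in> space M \<Longrightarrow> y \<in> space M \<Longrightarrow> v (f x) (f y) \<le> w x y"
  shows "property_tau (distr M N f) v"
proof (rule property_tauI)
  fix H F :: "'b \<Rightarrow> ennreal"
  assume "H \<in> borel_measurable (distr M N f)" "F \<in> borel_measurable (distr M N f)"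
  then have [measurable]: "H \<in> borel_measurable N" "F \<in> borel_measurable N" by simp_all
  assume HF: "\<And>x y. x \<in> space (distr M N f) \<Longrightarrow> y \<in> space (distr M N f) \<Longrightarrow>
    H x * F y \<le> ennreal (exp (v x y))"
  have "(\<integral>\<^sup>+x. H (f x) \<partial>M) * (\<integral>\<^sup>+x. F (f x) \<partial>M) \<le> 1"
  proof (rule property_tauD[OF M])
    fix x y assume xy: "x \<in> space M" "y \<in> space M"
    then have "H (f x) * F (f y) \<le> ennreal (exp (v (f x) (f y)))"
      by (intro HF) (auto simp: measurable_space[OF f])
    also have "\<dots> \<le> ennreal (exp (w x y))"
      using wv[OF xy] by (simp add: ennreal_leI)
    finally show "H (f x) * F (f y) \<le> ennreal (exp (w x y))" .
  qed measurable
  then show "integral\<^sup>N (distr M N f) H * integral\<^sup>N (distr M N f) F \<le> 1"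
    by (simp add: nn_integral_distr)
qed

lemma property_tau_PiM:
  fixes M :: "'i \<Rightarrow> 'a measure"
  assumes "finite I" and M: "\<And>i. prob_space (M i)" and w: "\<And>i. property_tau (M i) (w i)"
  shows "property_tau (\<Pi>\<^sub>M i\<in>I. M i) (\<lambda>x y. \<Sum>i\<in>I. w i (x i) (y i))"
  using \<open>finite I\<close>
proof induction
  case empty
  show ?case
  proof (rule property_tauI)
    fix H F :: "('i \<Rightarrow> 'a) \<Rightarrow> ennreal"
    assume HF: "\<And>x y. x \<in> space (Pi\<^sub>M {} M) \<Longrightarrow> y \<in> space (Pi\<^sub>M {} M) \<Longrightarrow>
      H x * F y \<le> ennreal (exp (\<Sum>i\<in>{}. w i (x i) (y i)))"
    \<comment> \<open>The empty product is a point mass and the empty sum is 0, so the constraint at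
      that single point is the claim.\<close>
    show "integral\<^sup>N (Pi\<^sub>M {} M) H * integral\<^sup>N (Pi\<^sub>M {} M) F \<le> 1"
      using HF[of "\<lambda>_. undefined" "\<lambda>_. undefined"]
      by (simp add: space_PiM PiM_empty nn_integral_count_space_finite)
  qed
next
  case (insert i I)
  interpret P: prob_space "Pi\<^sub>M I M" by (rule prob_space_PiM) (rule M)
  have "property_tau (distr (M i \<Otimes>\<^sub>M Pi\<^sub>M I M) (Pi\<^sub>M (insert i I) M) (\<lambda>(x, X). X(i := x)))
    (\<lambda>x y. \<Sum>i\<in>insert i I. w i (x i) (y i))"
  proof (rule property_tau_distr[OF property_tau_pair])
    show "sigma_finite_measure (Pi\<^sub>M I M)" ..
    show "property_tau (M i) (w i)" by (rule w)
    show "property_tau (Pi\<^sub>M I M) (\<lambda>x y. \<Sum>i\<in>I. w i (x i) (y i))" by (rule insert.IH)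
    fix p q
    have "(\<Sum>j\<in>I. w j (((snd p)(i := fst p)) j) (((snd q)(i := fst q)) j)) = (\<Sum>j\<in>I. w j (snd p j) (snd q j))"
      using insert.hyps by (intro sum.cong) auto
    then show "(\<Sum>j\<in>insert i I. w j ((case p of (x, X) \<Rightarrow> X(i := x)) j) ((case q of (x, X) \<Rightarrow> X(i := x)) j))
       \<le> w i (fst p) (fst q) + (\<Sum>j\<in>I. w j (snd p j) (snd q j))"
      using insert.hyps by (simp add: case_prod_beta)
  qed measurable
  then show ?case
    by (subst (asm) distr_pair_PiM_eq_PiM) (auto intro: M)
qed

section \<open>The one-sided exponential measure\<close>

text \<open>The parabola \<open>t\<^sup>2 / 18\<close> continued by its tangents at 2 and -2. It is
  the supremum of \<open>p * t - 9 / 2 * p\<^sup>2\<close> over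
  \<open>\<bar>p\<bar> \<le> 2 / 9\<close>.\<close>

definition maurey_cost :: "real \<Rightarrow> real" where
  "maurey_cost t = (if \<bar>t\<bar> \<le> 2 then t\<^sup>2 / 18 else 2 / 9 * (\<bar>t\<bar> - 1))"

definition maurey_deriv :: "real \<Rightarrow> real" where
  "maurey_deriv t = max (- 2) (min 2 t) / 9"

lemma DERIV_max_0_square: "DERIV (\<lambda>x::real. (max 0 x)\<^sup>2) x :> 2 * max 0 x"
proof (cases "x = 0")
  case True
  have "((\<lambda>h. (max 0 h)\<^sup>2 / h) \<longlongrightarrow> 0) (at (0::real))"
  proof (rule Lim_null_comparison)
    show "\<forall>\<^sub>F h in at (0::real). norm ((max 0 h)\<^sup>2 / h) \<le> \<bar>h\<bar>"
      by (intro always_eventually) (auto simp: max_def power2_eq_square)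
    show "((\<lambda>h. \<bar>h\<bar>) \<longlongrightarrow> 0) (at (0::real))"
      using tendsto_rabs_zero[OF tendsto_ident_at] by simp
  qed
  then show ?thesis using True by (simp add: DERIV_def)
next
  case False
  show ?thesis
  proof (cases "x > 0")
    case True
    have "DERIV (\<lambda>x::real. x\<^sup>2) x :> 2 * max 0 x"
      using True by (auto intro!: derivative_eq_intros)
    moreover have "\<forall>\<^sub>F y in nhds x. y\<^sup>2 = (max 0 y)\<^sup>2"
      unfolding eventually_nhds using True by (intro exI[of _ "{0<..}"]) auto
    ultimately show ?thesis
      using DERIV_cong_ev[OF refl _ refl, THEN iffD1] by fast
  next
    case F: False
    have "DERIV (\<lambda>x::real. 0) x :> 2 * max 0 x"
      using F by (auto intro!: derivative_eq_intros)
    moreover have "\<forall>\<^sub>F y in nhds x. 0 = (max 0 y)\<^sup>2"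
      unfolding eventually_nhds using F False by (intro exI[of _ "{..<0}"]) auto
    ultimately show ?thesis
      using DERIV_cong_ev[OF refl _ refl, THEN iffD1] by fast
  qed
qed

text \<open>The cost is \<open>t\<^sup>2\<close> minus the squared overshoots beyond 2 and below -2,
  divided by 18; this single formula also covers the gluing points.\<close>

lemma DERIV_maurey_cost: "DERIV maurey_cost t :> maurey_deriv t"
proof -
  have "DERIV (\<lambda>t. (t\<^sup>2 - (max 0 (t - 2))\<^sup>2 - (max 0 (- t - 2))\<^sup>2) / 18) t
      :> (2 * t - 2 * max 0 (t - 2) * 1 - 2 * max 0 (- t - 2) * (- 1)) / 18"
    by (intro DERIV_cdivide DERIV_diff DERIV_chain'[OF _ DERIV_max_0_square])
      (auto intro!: derivative_eq_intros)
  moreover have "(\<lambda>t. (t\<^sup>2 - (max 0 (t - 2))\<^sup>2 - (max 0 (- t - 2))\<^sup>2) / 18) = maurey_cost"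
    by (auto simp: fun_eq_iff maurey_cost_def max_def abs_if field_simps power2_eq_square)
  moreover have "(2 * t - 2 * max 0 (t - 2) * 1 - 2 * max 0 (- t - 2) * (- 1)) / 18 = maurey_deriv t"
    by (auto simp: maurey_deriv_def max_def min_def field_simps)
  ultimately show ?thesis by metis
qed

lemma maurey_cost_0 [simp]: "maurey_cost 0 = 0" by (simp add: maurey_cost_def)

lemma maurey_cost_minus [simp]: "maurey_cost (- t) = maurey_cost t" by (simp add: maurey_cost_def)

text \<open>The equality case of \<open>maurey_cost_ge_affine\<close>; together the two serve as
  convexity in what follows.\<close>

lemma maurey_cost_tangent: "maurey_cost t = maurey_deriv t * t - 9 / 2 * (maurey_deriv t)\<^sup>2"
  by (auto simp: maurey_cost_def maurey_deriv_def max_def min_def field_simps power2_eq_square)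

lemma abs_maurey_deriv_le: "\<bar>maurey_deriv t\<bar> \<le> 2 / 9"
  by (auto simp: maurey_deriv_def)

lemma maurey_cost_ge_affine:
  assumes p: "\<bar>p\<bar> \<le> 2 / 9"
  shows "p * t - 9 / 2 * p\<^sup>2 \<le> maurey_cost t"
proof (cases "\<bar>t\<bar> \<le> 2")
  case True
  have "0 \<le> (t - 9 * p)\<^sup>2" by simp
  with True show ?thesis by (simp add: maurey_cost_def power2_eq_square field_simps)
next
  case False
  \<comment> \<open>On the affine branch the gap is at least this sum of a square and a product of
    two nonnegative factors.\<close>
  have "0 \<le> 9 / 2 * (\<bar>p\<bar> - 2 / 9)\<^sup>2 + (2 / 9 - \<bar>p\<bar>) * (\<bar>t\<bar> - 2)"
    using p False by (intro add_nonneg_nonneg mult_nonneg_nonneg) auto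
  also have "\<dots> = 2 / 9 * (\<bar>t\<bar> - 1) - (\<bar>p * t\<bar> - 9 / 2 * \<bar>p\<bar>\<^sup>2)"
    by (simp add: power2_eq_square field_simps abs_mult)
  finally show ?thesis
    using False abs_ge_self[of "p * t"] by (simp add: maurey_cost_def)
qed

text \<open>The tangent at \<open>s\<close> is compared with the affine minorant of the same slope
  at \<open>t\<close>.\<close>

lemma maurey_cost_lipschitz: "maurey_cost s \<le> maurey_cost t + 2 / 9 * \<bar>s - t\<bar>"
proof -
  have "maurey_deriv s * (s - t) \<le> 2 / 9 * \<bar>s - t\<bar>"
    using abs_maurey_deriv_le[of s] abs_ge_self[of "maurey_deriv s * (s - t)"]
      mult_right_mono[of "\<bar>maurey_deriv s\<bar>" "2 / 9" "\<bar>s - t\<bar>"] by (simp add: abs_mult)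
  then show ?thesis
    using maurey_cost_tangent[of s] maurey_cost_ge_affine[OF abs_maurey_deriv_le[of s], of t]
    by (simp add: algebra_simps)
qed

text \<open>The inequality that the constants of the cost are tuned for: it is nearly sharp at \<open>\<bar>t\<bar> = 2\<close>.\<close>

lemma maurey_cost_decay: "exp (- maurey_cost t) \<le> 1 - (2 * maurey_deriv t)\<^sup>2"
proof -
  \<comment> \<open>For \<open>\<bar>t\<bar> \<le> 2\<close> and \<open>s = t\<^sup>2 / 18\<close>,
    the term \<open>(2 * maurey_deriv t)\<^sup>2\<close> equals \<open>8 / 9 * s\<close>. Beyond 2
    the derivative is frozen while the cost grows, so \<open>s = 2 / 9\<close> suffices.\<close>
  have *: "exp (- s) \<le> 1 - 8 / 9 * s" if s: "0 \<le> s" "s \<le> 2 / 9" for s :: real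
  proof -
    have "s\<^sup>2 \<le> (2/9)\<^sup>2"
      using s by (intro power_mono) auto
    \<comment> \<open>The bracket decreases in \<open>s\<close> and is still \<open>2 / 729\<close>
      at \<open>s = 2 / 9\<close>.\<close>
    then have "0 \<le> s * (1 / 9 - 7 / 18 * s - 4 / 9 * s\<^sup>2)"
      using s by (intro mult_nonneg_nonneg) (auto simp: power2_eq_square)
    also have "\<dots> = (1 - 8 / 9 * s) * (1 + s + s\<^sup>2 / 2) - 1"
      by (simp add: field_simps power2_eq_square)
    also have "\<dots> \<le> (1 - 8 / 9 * s) * exp s - 1"
      using s by (intro diff_right_mono mult_left_mono exp_lower_Taylor_quadratic) auto
    finally show ?thesis by (simp add: exp_minus field_simps)
  qed
  show ?thesis
  proof (cases "\<bar>t\<bar> \<le> 2")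
    case True
    then have "t\<^sup>2 \<le> 2\<^sup>2" by (metis abs_le_square_iff abs_numeral)
    then have "exp (- (t\<^sup>2 / 18)) \<le> 1 - 8 / 9 * (t\<^sup>2 / 18)" by (intro *) auto
    with True show ?thesis by (simp add: maurey_cost_def maurey_deriv_def power2_eq_square)
  next
    case False
    then have "exp (- maurey_cost t) \<le> exp (- (2 / 9))" by (simp add: maurey_cost_def)
    also have "\<dots> \<le> 1 - 8 / 9 * (2 / 9)" by (rule *) auto
    finally show ?thesis
      using False by (auto simp: maurey_deriv_def power2_eq_square max_def min_def split: if_splits)
  qed
qed

text \<open>Minorants of a common slope \<open>p\<close> at \<open>a\<close> and at
  \<open>- b\<close> add up to twice the tangent value at \<open>(a - b) / 2\<close>; evenness turns
  \<open>- b\<close> into \<open>b\<close>.\<close>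

lemma maurey_cost_half_diff: "2 * maurey_cost ((a - b) / 2) \<le> maurey_cost a + maurey_cost b"
proof -
  define p where "p = maurey_deriv ((a - b) / 2)"
  have "\<bar>p\<bar> \<le> 2 / 9" unfolding p_def by (rule abs_maurey_deriv_le)
  then have "p * a - 9 / 2 * p\<^sup>2 \<le> maurey_cost a" "p * (- b) - 9 / 2 * p\<^sup>2 \<le> maurey_cost (- b)"
    by (rule maurey_cost_ge_affine)+
  moreover have "2 * maurey_cost ((a - b) / 2) = p * (a - b) - 9 * p\<^sup>2"
    using maurey_cost_tangent[of "(a - b) / 2"] by (simp add: field_simps flip: p_def)
  ultimately show ?thesis by (simp add: algebra_simps)
qed

section \<open>Monotone transport on a bounded interval\<close>

text \<open>The change of variables in differentiated form: \<open>G\<close> is nondecreasing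
  because \<open>exp (- z x) * z'\<close> dominates \<open>\<kappa> / I * u x\<close>. Comparing its
  values at 0 and \<open>R\<close> gives \<open>\<kappa> \<le> 1 - exp (- z R)\<close>, where
  \<open>\<kappa>\<close> is the geometric mean of the two integrals.\<close>

lemma exp_interval_transport:
  fixes u v :: "real \<Rightarrow> real"
  assumes cu: "continuous_on UNIV u" and cv: "continuous_on UNIV v"
    and u: "\<And>x. 0 < u x" and v: "\<And>x. 0 < v x"
    and uv: "\<And>x y. u x * v y \<le> exp (maurey_cost (x - y) - x - y)"
    and R: "0 < R"
  shows "integral {0..R} u * integral {0..R} v \<le> 1"
proof -
  define U where "U x = integral {0..x} u" for x
  define V where "V x = integral {0..x} v" for x
  have DU0: "(U has_real_derivative u x) (at x within {0..R})" if "x \<in> {0..R}" for x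
    unfolding U_def using that by (intro integral_has_real_derivative continuous_on_subset[OF cu]) auto
  have DV0: "(V has_real_derivative v x) (at x within {0..R})" if "x \<in> {0..R}" for x
    unfolding V_def using that by (intro integral_has_real_derivative continuous_on_subset[OF cv]) auto
  have cU: "continuous_on {0..R} U" and cV: "continuous_on {0..R} V"
    by (rule DERIV_continuous_on, erule DU0 DV0)+
  have DU: "DERIV U x :> u x" and DV: "DERIV V x :> v x" if "0 < x" "x < R" for x
    using DU0[of x] DV0[of x] that by (simp_all add: at_within_Icc_at)
  have U_mono: "U x < U y" if "0 \<le> x" "x < y" "y \<le> R" for x y
  proof (rule DERIV_pos_imp_increasing_open[OF \<open>x < y\<close>])
    show "\<exists>d. DERIV U s :> d \<and> 0 < d" if "x < s" "s < y" for s
      using DU[of s] u[of s] that \<open>0 \<le> x\<close> \<open>y \<le> R\<close> by auto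
    show "continuous_on {x..y} U"
      using that by (intro continuous_on_subset[OF cU]) auto
  qed
  have V_mono: "V x < V y" if "0 \<le> x" "x < y" "y \<le> R" for x y
  proof (rule DERIV_pos_imp_increasing_open[OF \<open>x < y\<close>])
    show "\<exists>d. DERIV V s :> d \<and> 0 < d" if "x < s" "s < y" for s
      using DV[of s] v[of s] that \<open>0 \<le> x\<close> \<open>y \<le> R\<close> by auto
    show "continuous_on {x..y} V"
      using that by (intro continuous_on_subset[OF cV]) auto
  qed
  have [simp]: "U 0 = 0" "V 0 = 0" by (simp_all add: U_def V_def)
  define I where "I = U R"
  define J where "J = V R"
  have I: "0 < I" and J: "0 < J"
    using U_mono[of 0 R] V_mono[of 0 R] R by (simp_all add: I_def J_def)
  have inj: "inj_on V {0..R}"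
    by (rule strict_mono_on_imp_inj_on) (auto simp: strict_mono_on_def intro: V_mono)
  have img: "V ` {0..R} = {0..J}"
  proof
    have "0 \<le> V x \<and> V x \<le> J" if "x \<in> {0..R}" for x
      using V_mono[of 0 x] V_mono[of x R] that by (cases "x = 0"; cases "x = R") (auto simp: J_def)
    then show "V ` {0..R} \<subseteq> {0..J}" by auto
    show "{0..J} \<subseteq> V ` {0..R}"
    proof
      fix y assume "y \<in> {0..J}"
      then show "y \<in> V ` {0..R}"
        using IVT'[of V 0 y R] cV R by (auto simp: J_def)
    qed
  qed
  define W where "W = the_inv_into {0..R} V"
  have WV: "W (V x) = x" if "x \<in> {0..R}" for x
    unfolding W_def using inj that by (rule the_inv_into_f_f)
  have VW: "V (W y) = y" "W y \<in> {0..R}" if "y \<in> {0..J}" for y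
  proof -
    have "y \<in> V ` {0..R}" using that unfolding img .
    then obtain x where x: "y = V x" "x \<in> {0..R}" by (rule imageE)
    show "V (W y) = y" "W y \<in> {0..R}" unfolding x(1) WV[OF x(2)] by (rule refl x(2))+
  qed
  have cW: "continuous_on {0..J} W"
    unfolding img[symmetric] using WV by (intro continuous_on_inv cV) auto
  have W_pos: "0 < W y" "W y < R" if "0 < y" "y < J" for y
  proof -
    have "W y \<noteq> 0" "W y \<noteq> R" using VW(1)[of y] that by (auto simp: J_def)
    then show "0 < W y" "W y < R" using VW(2)[of y] that by auto
  qed
  have DW: "DERIV W y :> inverse (v (W y))" if y: "0 < y" "y < J" for y
  proof (rule DERIV_inverse_function[where f = V and a = 0 and b = J])
    show "DERIV V (W y) :> v (W y)" using W_pos[OF y] by (rule DV)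
    show "v (W y) \<noteq> 0" using v[of "W y"] by simp
    show "isCont W y" using cW y by (intro continuous_on_interior[of "{0..J}"]) auto
  qed (use y VW in auto)
  \<comment> \<open>Thus \<open>V (T x) / J = U x / I\<close>: \<open>T\<close> matches the
    normalized masses of \<open>u\<close> and \<open>v\<close> lying to the left.\<close>
  define T where "T x = W (J / I * U x)" for x
  have JU: "J / I * U x \<in> {0..J}" if "x \<in> {0..R}" for x
  proof -
    have "0 \<le> U x" "U x \<le> I"
      using U_mono[of 0 x] U_mono[of x R] that by (cases "x = 0"; cases "x = R"; auto simp: I_def)+
    then show ?thesis using I J by (simp add: field_simps)
  qed
  have JU': "0 < J / I * U x" "J / I * U x < J" if "0 < x" "x < R" for x
  proof -
    have "0 < U x" "U x < I"
      using U_mono[of 0 x] U_mono[of x R] that by (simp_all add: I_def)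
    then show "0 < J / I * U x" "J / I * U x < J" using I J by (simp_all add: field_simps)
  qed
  have cT: "continuous_on {0..R} T"
    unfolding T_def using JU
    by (intro continuous_on_compose2[OF cW] continuous_intros cU) auto
  have T0: "T 0 = 0" using WV[of 0] R by (simp add: T_def)
  define T' where "T' x = inverse (v (T x)) * (J / I * u x)" for x
  have DT: "DERIV T x :> T' x" if "0 < x" "x < R" for x
    unfolding T_def[abs_def] T'_def
    using DERIV_chain'[OF DERIV_cmult[OF DU[OF that]] DW[OF JU'[OF that]]] by (simp add: mult_ac T_def)
  define z where "z x = (x + T x) / 2 - maurey_cost (x - T x)" for x
  define \<kappa> where "\<kappa> = sqrt (I * J)"
  define G where "G x = - exp (- z x) - \<kappa> / I * U x" for x
  have cw: "continuous_on UNIV maurey_cost"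
    by (rule DERIV_continuous_on) (rule has_field_derivative_at_within[OF DERIV_maurey_cost])
  have "G 0 \<le> G R"
  proof (rule DERIV_nonneg_imp_increasing_open[where f = G])
    show "0 \<le> R" using R by simp
    show "continuous_on {0..R} G"
      unfolding G_def z_def
      by (intro continuous_intros cT cU continuous_on_compose2[OF cw]) auto
    fix x assume x: "0 < x" "x < R"
    define d where "d = 2 * maurey_deriv (x - T x)"
    define z' where "z' = ((1 - d) + (1 + d) * T' x) / 2"
    have "DERIV z x :> (1 + T' x) / 2 - maurey_deriv (x - T x) * (1 - T' x)"
      unfolding z_def
      using DERIV_diff[OF DERIV_cdivide[OF DERIV_add[OF DERIV_ident DT[OF x]]]
          DERIV_chain'[OF DERIV_diff[OF DERIV_ident DT[OF x]] DERIV_maurey_cost], of 2] by (simp add: mult_ac)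
    also have "(1 + T' x) / 2 - maurey_deriv (x - T x) * (1 - T' x) = z'"
      by (simp add: z'_def d_def field_simps)
    finally have Dz: "DERIV z x :> z'" .
    have DG: "DERIV G x :> exp (- z x) * z' - \<kappa> / I * u x"
      unfolding G_def
      using DERIV_diff[OF DERIV_minus[OF DERIV_chain'[OF DERIV_minus[OF Dz] DERIV_exp]]
          DERIV_cmult[OF DU[OF x]], of "\<kappa> / I"] by (simp add: mult_ac)
    have T'_pos: "0 < T' x" using I J u v by (simp add: T'_def)
    have d: "\<bar>d\<bar> \<le> 1" using abs_maurey_deriv_le[of "x - T x"] by (simp add: d_def abs_mult)
    \<comment> \<open>AM-GM: \<open>z'\<close> is the mean of \<open>1 - d\<close> and \<open>(1 + d) * T' x\<close>, and the
      factor \<open>1 - d\<^sup>2\<close> lost in the product is paid for by \<open>maurey_cost_decay\<close>.\<close>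
    have "(\<kappa> / I * u x)\<^sup>2 = J / I * (u x)\<^sup>2"
    proof -
      have "\<kappa>\<^sup>2 = I * J" using I J by (simp add: \<kappa>_def)
      then show ?thesis using I by (simp add: power_mult_distrib power_divide) (simp add: power2_eq_square)
    qed
    also have "\<dots> = (u x * v (T x)) * T' x"
      using v[of "T x"] by (simp add: T'_def power2_eq_square)
    also have "\<dots> \<le> exp (maurey_cost (x - T x) - x - T x) * T' x"
      using uv T'_pos by (intro mult_right_mono) auto
    \<comment> \<open>By the definition of \<open>z\<close>, the exponent is
      \<open>- 2 * z x - maurey_cost (x - T x)\<close>; the copy of the cost left over supplies the
      decay.\<close>
    also have "\<dots> = (exp (- z x))\<^sup>2 * exp (- maurey_cost (x - T x)) * T' x"
      by (simp add: z_def field_simps flip: exp_add exp_double)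
    also have "\<dots> \<le> (exp (- z x))\<^sup>2 * (1 - d\<^sup>2) * T' x"
      using maurey_cost_decay[of "x - T x"] T'_pos by (intro mult_right_mono mult_left_mono) (auto simp: d_def)
    also have "\<dots> = (exp (- z x))\<^sup>2 * ((1 - d) * ((1 + d) * T' x))"
      by (simp add: power2_eq_square algebra_simps)
    also have "\<dots> \<le> (exp (- z x))\<^sup>2 * z'\<^sup>2"
    proof (rule mult_left_mono)
      have "0 \<le> ((1 - d) - (1 + d) * T' x)\<^sup>2" by simp
      then show "(1 - d) * ((1 + d) * T' x) \<le> z'\<^sup>2"
        unfolding z'_def by (simp add: power2_eq_square field_simps)
    qed simp
    finally have "(\<kappa> / I * u x)\<^sup>2 \<le> (exp (- z x) * z')\<^sup>2" by (simp add: power_mult_distrib)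
    moreover have "0 \<le> exp (- z x) * z'"
      using d T'_pos by (simp add: z'_def)
    ultimately have "\<kappa> / I * u x \<le> exp (- z x) * z'" by (rule power2_le_imp_le)
    then show "\<exists>y. DERIV G x :> y \<and> 0 \<le> y" using DG by force
  qed
  moreover have "G 0 = - 1" by (simp add: G_def z_def T0)
  moreover have "G R = - exp (- z R) - \<kappa>" using I by (simp add: G_def I_def[symmetric])
  ultimately have "\<kappa> \<le> 1" using exp_gt_zero[of "- z R"] by linarith
  then have "I * J \<le> 1" by (simp add: \<kappa>_def)
  then show ?thesis unfolding I_def J_def U_def V_def .
qed

section \<open>Lipschitz regularization of the constraint\<close>

text \<open>The sup-convolution of \<open>ln f\<close> with \<open>- L * \<bar>x\<bar>\<close>,
  written in exponentiated form so that \<open>f\<close> may vanish.\<close>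

definition log_lipschitz_hull :: "real \<Rightarrow> (real \<Rightarrow> real) \<Rightarrow> real \<Rightarrow> real" where
  "log_lipschitz_hull L f x = (SUP y. f y * exp (- (L * \<bar>x - y\<bar>)))"

context
  fixes L :: real and f :: "real \<Rightarrow> real"
  assumes L: "0 \<le> L" and bdd: "\<And>x. bdd_above (range (\<lambda>y. f y * exp (- (L * \<bar>x - y\<bar>))))"
    and nonneg: "\<And>y. 0 \<le> f y"
begin

lemma log_lipschitz_hull_upper: "f y * exp (- (L * \<bar>x - y\<bar>)) \<le> log_lipschitz_hull L f x"
  unfolding log_lipschitz_hull_def by (rule cSUP_upper[OF UNIV_I bdd])

lemma log_lipschitz_hull_ge: "f x \<le> log_lipschitz_hull L f x"
  using log_lipschitz_hull_upper[of x x] by simp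

lemma log_lipschitz_hull_pos: "0 < f b \<Longrightarrow> 0 < log_lipschitz_hull L f x"
  by (rule less_le_trans[OF _ log_lipschitz_hull_upper[of b x]]) simp

lemma log_lipschitz_hull_lipschitz: "log_lipschitz_hull L f x \<le> exp (L * \<bar>x - y\<bar>) * log_lipschitz_hull L f y"
proof -
  have "f z * exp (- (L * \<bar>x - z\<bar>)) \<le> exp (L * \<bar>x - y\<bar>) * log_lipschitz_hull L f y" for z
  proof -
    have "L * \<bar>y - z\<bar> \<le> L * (\<bar>x - y\<bar> + \<bar>x - z\<bar>)"
      using L by (intro mult_left_mono) auto
    then have "f z * exp (- (L * \<bar>x - z\<bar>)) \<le> f z * exp (L * \<bar>x - y\<bar> + - (L * \<bar>y - z\<bar>))"
      using nonneg by (intro mult_left_mono) (auto simp: algebra_simps)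
    also have "\<dots> = exp (L * \<bar>x - y\<bar>) * (f z * exp (- (L * \<bar>y - z\<bar>)))"
      by (simp only: exp_add mult_ac)
    also have "\<dots> \<le> exp (L * \<bar>x - y\<bar>) * log_lipschitz_hull L f y"
      by (intro mult_left_mono log_lipschitz_hull_upper) simp
    finally show ?thesis .
  qed
  then show ?thesis
    by (subst log_lipschitz_hull_def) (intro cSUP_least; simp)
qed

text \<open>One positive value of \<open>f\<close> makes the hull positive everywhere, so its
  logarithm is a genuine \<open>L\<close>-Lipschitz function.\<close>

lemma continuous_on_log_lipschitz_hull:
  assumes "0 < f b"
  shows "continuous_on UNIV (log_lipschitz_hull L f)"
proof -
  note pos = log_lipschitz_hull_pos[OF assms]
  have *: "ln (log_lipschitz_hull L f x) - ln (log_lipschitz_hull L f y) \<le> L * \<bar>x - y\<bar>" for x y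
  proof -
    have "ln (log_lipschitz_hull L f x) \<le> ln (exp (L * \<bar>x - y\<bar>) * log_lipschitz_hull L f y)"
      using log_lipschitz_hull_lipschitz[of x y] pos[of x] by simp
    also have "\<dots> = L * \<bar>x - y\<bar> + ln (log_lipschitz_hull L f y)"
      using pos[of y] by (subst ln_mult) auto
    finally show ?thesis by simp
  qed
  have "L-lipschitz_on UNIV (\<lambda>x. ln (log_lipschitz_hull L f x))"
  proof (rule lipschitz_onI)
    show "dist (ln (log_lipschitz_hull L f x)) (ln (log_lipschitz_hull L f y)) \<le> L * dist x y" for x y
      using *[of x y] *[of y x] by (simp add: dist_real_def abs_minus_commute abs_le_iff)
  qed (fact L)
  then have "continuous_on UNIV (\<lambda>x. exp (ln (log_lipschitz_hull L f x)))"
    by (intro continuous_intros lipschitz_on_continuous_on)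
  then show ?thesis using pos by simp
qed

end

text \<open>
  The cost is \<open>2 / 9\<close>-Lipschitz, so the constraint survives replacing both functions by their smallest
  majorants with \<open>2 / 9\<close>-Lipschitz logarithm. This makes arbitrary functions continuous and positive.
\<close>

lemma lipschitz_majorants:
  fixes h f :: "real \<Rightarrow> real"
  assumes h: "\<And>x. 0 \<le> h x" "0 < h a" and f: "\<And>x. 0 \<le> f x" "0 < f b"
    and hf: "\<And>x y. h x * f y \<le> exp (maurey_cost (x - y))"
  obtains h' f' where "continuous_on UNIV h'" "continuous_on UNIV f'"
    "\<And>x. 0 < h' x" "\<And>x. 0 < f' x" "\<And>x. h x \<le> h' x" "\<And>x. f x \<le> f' x"
    "\<And>x y. h' x * f' y \<le> exp (maurey_cost (x - y))"
proof -
  let ?L = "2 / 9 :: real"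
  let ?e = "\<lambda>x y :: real. exp (- (?L * \<bar>x - y\<bar>))"
  \<comment> \<open>Moving the two points changes the cost by at most \<open>2 / 9\<close> times the
    total displacement, exactly what the two exponential factors pay for.\<close>
  have bound: "h x' * ?e x x' * (f y' * ?e y y') \<le> exp (maurey_cost (x - y))" for x y x' y'
  proof -
    have "h x' * ?e x x' * (f y' * ?e y y') = (h x' * f y') * (?e x x' * ?e y y')" by simp
    also have "\<dots> \<le> exp (maurey_cost (x' - y')) * (?e x x' * ?e y y')"
      by (intro mult_right_mono hf) simp
    also have "\<dots> = exp (maurey_cost (x' - y') - ?L * \<bar>x - x'\<bar> - ?L * \<bar>y - y'\<bar>)"
      by (simp flip: exp_add)
    also have "\<dots> \<le> exp (maurey_cost (x - y))"
      using maurey_cost_lipschitz[of "x' - y'" "x - y"] by (simp add: field_simps abs_if split: if_splits)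
    finally show ?thesis .
  qed
  have bh: "bdd_above (range (\<lambda>y. h y * ?e x y))" for x
  proof (rule bdd_aboveI2)
    show "h y * ?e x y \<le> exp (maurey_cost (x - b)) / f b" for y
      using bound[of y x b b] f(2) by (simp add: field_simps)
  qed
  have bf: "bdd_above (range (\<lambda>y. f y * ?e x y))" for x
  proof (rule bdd_aboveI2)
    show "f y * ?e x y \<le> exp (maurey_cost (a - x)) / h a" for y
      using bound[of a a y x] h(2) by (simp add: field_simps)
  qed
  have L: "0 \<le> ?L" by simp
  show thesis
  proof (rule that[of "log_lipschitz_hull ?L h" "log_lipschitz_hull ?L f"])
    fix x y
    \<comment> \<open>The suprema are taken one at a time, first over the points of \<open>f\<close>
      with \<open>x'\<close> fixed. Each step divides by the other factor, hence the separate case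
      of a vanishing \<open>h x'\<close>.\<close>
    have *: "h x' * ?e x x' * log_lipschitz_hull ?L f y \<le> exp (maurey_cost (x - y))" for x'
    proof (cases "h x' = 0")
      case False
      then have pos: "0 < h x' * ?e x x'" using h(1)[of x'] by simp
      have "log_lipschitz_hull ?L f y \<le> exp (maurey_cost (x - y)) / (h x' * ?e x x')"
        unfolding log_lipschitz_hull_def
      proof (rule cSUP_least)
        show "f y' * ?e y y' \<le> exp (maurey_cost (x - y)) / (h x' * ?e x x')" for y'
          using bound[of x' x y' y] by (subst pos_le_divide_eq[OF pos]) (simp add: mult_ac)
      qed simp
      then show ?thesis by (subst (asm) pos_le_divide_eq[OF pos]) (simp add: mult_ac)
    qed simp
    have pos: "0 < log_lipschitz_hull ?L f y" by (rule log_lipschitz_hull_pos[OF L bf f])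
    have "log_lipschitz_hull ?L h x \<le> exp (maurey_cost (x - y)) / log_lipschitz_hull ?L f y"
      unfolding log_lipschitz_hull_def[of _ h]
      by (rule cSUP_least) (simp, subst pos_le_divide_eq[OF pos], rule *)
    then show "log_lipschitz_hull ?L h x * log_lipschitz_hull ?L f y \<le> exp (maurey_cost (x - y))"
      by (subst (asm) pos_le_divide_eq[OF pos])
  qed (rule continuous_on_log_lipschitz_hull[OF L bh h] continuous_on_log_lipschitz_hull[OF L bf f]
      log_lipschitz_hull_pos[OF L bh h] log_lipschitz_hull_pos[OF L bf f]
      log_lipschitz_hull_ge[OF L bh h(1)] log_lipschitz_hull_ge[OF L bf f(1)])+
qed

section \<open>Passage to the half-line\<close>

abbreviation exp_measure :: "real measure" where
  "exp_measure \<equiv> density lborel (\<lambda>x. ennreal (exponential_density 1 x))"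

lemma nn_integral_exp_measure:
  assumes [measurable]: "f \<in> borel_measurable borel"
  shows "(\<integral>\<^sup>+x. f x \<partial>exp_measure) = (\<integral>\<^sup>+x. f x * ennreal (exp (- x)) * indicator {0..} x \<partial>lborel)"
  by (subst nn_integral_density)
    (auto intro!: nn_integral_cong simp: exponential_density_def mult_ac split: split_indicator)

text \<open>Monotone convergence over growing intervals, linking the integrals of the transport
  bound with those against the measure.\<close>

lemma nn_integral_atLeast_eq_SUP:
  fixes u :: "real \<Rightarrow> real"
  assumes cu: "continuous_on UNIV u" and u: "\<And>x. 0 \<le> u x"
  shows "(\<integral>\<^sup>+x. ennreal (u x) * indicator {0..} x \<partial>lborel) = (SUP n. ennreal (integral {0..real n} u))"
proof -
  have [measurable]: "u \<in> borel_measurable borel"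
    using cu by (rule borel_measurable_continuous_onI)
  have "(SUP n. ennreal (u x) * indicator {0..real n} x) = ennreal (u x) * indicator {0..} x" for x
  proof -
    obtain m where m: "x \<le> real m" using real_arch_simple by blast
    have "(SUP n. indicator {0..real n} x :: ennreal) = indicator {0..} x"
    proof (rule antisym)
      show "(SUP n. indicator {0..real n} x :: ennreal) \<le> indicator {0..} x"
        by (rule SUP_least) (auto split: split_indicator)
      have "indicator {0..} x = (indicator {0..real m} x :: ennreal)"
        using m by (auto split: split_indicator)
      then show "indicator {0..} x \<le> (SUP n. indicator {0..real n} x :: ennreal)"
        by (auto intro: SUP_upper)
    qed
    then show ?thesis by (simp flip: SUP_mult_left_ennreal)
  qed
  then have "(\<integral>\<^sup>+x. ennreal (u x) * indicator {0..} x \<partial>lborel)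
      = (\<integral>\<^sup>+x. (SUP n. ennreal (u x) * indicator {0..real n} x) \<partial>lborel)"
    by simp
  also have "\<dots> = (SUP n. \<integral>\<^sup>+x. ennreal (u x) * indicator {0..real n} x \<partial>lborel)"
    by (intro nn_integral_monotone_convergence_SUP)
      (auto simp: incseq_def le_fun_def split: split_indicator)
  also have "\<dots> = (SUP n. ennreal (integral {0..real n} u))"
    by (intro SUP_cong refl nn_integral_has_integral_lebesgue' integrable_integral
        integrable_continuous_real continuous_on_subset[OF cu] u) auto
  finally show ?thesis .
qed

text \<open>Majorants can only enlarge the integrals, so positive continuous functions suffice. The
  density is absorbed into \<open>u\<close> and \<open>v\<close>, and the interval bound passes to
  the limit.\<close>

lemma property_tau_exp_measure: "property_tau exp_measure (\<lambda>x y. maurey_cost (x - y))"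
proof (rule property_tauI)
  fix H F :: "real \<Rightarrow> ennreal"
  assume "H \<in> borel_measurable exp_measure" "F \<in> borel_measurable exp_measure"
  then have [measurable]: "H \<in> borel_measurable borel" "F \<in> borel_measurable borel" by simp_all
  assume "\<And>x y. x \<in> space exp_measure \<Longrightarrow> y \<in> space exp_measure \<Longrightarrow>
    H x * F y \<le> ennreal (exp (maurey_cost (x - y)))"
  then have HF: "H x * F y \<le> ennreal (exp (maurey_cost (x - y)))" for x y by simp
  show "integral\<^sup>N exp_measure H * integral\<^sup>N exp_measure F \<le> 1"
  proof (cases "(\<forall>x. H x = 0) \<or> (\<forall>x. F x = 0)")
    case True
    then have "integral\<^sup>N exp_measure H = 0 \<or> integral\<^sup>N exp_measure F = 0"
      by (auto simp: fun_eq_iff[symmetric])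
    then show ?thesis by auto
  next
    case False
    then obtain a b where ab: "H a \<noteq> 0" "F b \<noteq> 0" by auto
    \<comment> \<open>An infinite value of one function would violate the constraint against a
      nonzero value of the other.\<close>
    have fin: "H x \<noteq> \<top>" "F x \<noteq> \<top>" for x
      using HF[of x b] HF[of a x] ab by (auto simp: ennreal_top_mult ennreal_mult_top top_unique)
    define h where "h x = enn2real (H x)" for x
    define f where "f x = enn2real (F x)" for x
    have eq: "H x = ennreal (h x)" "F x = ennreal (f x)" for x
      using fin[of x] by (simp_all add: h_def f_def less_top[symmetric])
    have nn: "0 \<le> h x" "0 \<le> f x" for x by (simp_all add: h_def f_def)
    have "h x * f y \<le> exp (maurey_cost (x - y))" for x y
      using HF[of x y] nn[of x] nn[of y] by (simp add: eq flip: ennreal_mult)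
    moreover have "0 < h a" "0 < f b"
      using ab nn[of a] nn[of b] by (auto simp: eq less_le)
    ultimately obtain h' f' where cont: "continuous_on UNIV h'" "continuous_on UNIV f'"
      and pos: "\<And>x. 0 < h' x" "\<And>x. 0 < f' x" and le: "\<And>x. h x \<le> h' x" "\<And>x. f x \<le> f' x"
      and hf': "\<And>x y. h' x * f' y \<le> exp (maurey_cost (x - y))"
      using lipschitz_majorants[of h a f b] nn by metis
    define u where "u x = h' x * exp (- x)" for x
    define v where "v x = f' x * exp (- x)" for x
    have cuv: "continuous_on UNIV u" "continuous_on UNIV v"
      unfolding u_def v_def by (intro continuous_intros cont)+
    have uv: "0 < u x" "0 < v x" for x using pos by (simp_all add: u_def v_def)
    have bound: "u x * v y \<le> exp (maurey_cost (x - y) - x - y)" for x y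
    proof -
      have "u x * v y = h' x * f' y * exp (- x - y)"
        by (simp add: u_def v_def exp_diff exp_minus field_simps)
      also have "\<dots> \<le> exp (maurey_cost (x - y)) * exp (- x - y)"
        by (intro mult_right_mono hf') simp
      finally show ?thesis by (simp add: algebra_simps flip: exp_add)
    qed
    let ?U = "\<lambda>n. ennreal (integral {0..real n} u)"
    let ?V = "\<lambda>n. ennreal (integral {0..real n} v)"
    have int: "u integrable_on {0..r}" "v integrable_on {0..r}" for r
      by (intro integrable_continuous_real continuous_on_subset[OF cuv(1)]
          continuous_on_subset[OF cuv(2)]; simp)+
    have UV: "?U m * ?V n \<le> 1" for m n
    proof -
      \<comment> \<open>A common interval for both integrals; \<open>Suc\<close> keeps its length
        positive.\<close>
      define k where "k = Suc (max m n)"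
      have "?U m * ?V n \<le> ?U k * ?V k"
        using uv by (intro mult_mono ennreal_leI integral_subset_le int) (auto simp: k_def less_imp_le)
      also have "\<dots> = ennreal (integral {0..real k} u * integral {0..real k} v)"
        using uv by (intro ennreal_mult[symmetric] integral_nonneg int) (auto simp: less_imp_le)
      also have "\<dots> \<le> ennreal 1"
        by (intro ennreal_leI exp_interval_transport cuv uv bound) (simp add: k_def)
      finally show ?thesis by simp
    qed
    have "integral\<^sup>N exp_measure H * integral\<^sup>N exp_measure F
      \<le> (\<integral>\<^sup>+x. ennreal (u x) * indicator {0..} x \<partial>lborel) * (\<integral>\<^sup>+x. ennreal (v x) * indicator {0..} x \<partial>lborel)"
      unfolding nn_integral_exp_measure[OF \<open>H \<in> borel_measurable borel\<close>]
        nn_integral_exp_measure[OF \<open>F \<in> borel_measurable borel\<close>]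
      using le nn
      by (intro mult_mono nn_integral_mono)
        (auto simp: eq u_def v_def ennreal_mult'' split: split_indicator intro!: mult_right_mono ennreal_leI)
    also have "\<dots> = (SUP n. ?U n) * (SUP n. ?V n)"
      using uv by (simp add: nn_integral_atLeast_eq_SUP cuv less_imp_le)
    also have "\<dots> = (SUP m. SUP n. ?U m * ?V n)"
      by (simp flip: SUP_mult_left_ennreal SUP_mult_right_ennreal)
    also have "\<dots> \<le> 1" by (intro SUP_least UV)
    finally show ?thesis .
  qed
qed

section \<open>The two-sided exponential measure\<close>

text \<open>This is the density at \<open>z\<close> of the difference of two independent exponential
  variables. Both factors are nonzero exactly for \<open>y\<close> at or above 0 and
  \<open>- z\<close>, which is the choice of \<open>a\<close>.\<close>

lemma nn_integral_exponential_density_shift: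
  "(\<integral>\<^sup>+y. ennreal (exponential_density 1 (z + y)) * ennreal (exponential_density 1 y) \<partial>lborel)
    = ennreal (exp (- \<bar>z\<bar>) / 2)"
proof -
  define a where "a = max 0 (- z)"
  have "(\<integral>\<^sup>+y. ennreal (exponential_density 1 (z + y)) * ennreal (exponential_density 1 y) \<partial>lborel)
      = (\<integral>\<^sup>+y. ennreal (exp (- z - 2 * y)) * indicator {a..} y \<partial>lborel)"
    by (intro nn_integral_cong)
      (auto simp: exponential_density_def a_def split: split_indicator simp flip: ennreal_mult exp_add)
  also have "\<dots> = ennreal (0 - (- exp (- z - 2 * a) / 2))"
  proof (rule nn_integral_FTC_atLeast)
    show "DERIV (\<lambda>y. - exp (- z - 2 * y) / 2) y :> exp (- z - 2 * y)" for y
      by (auto intro!: derivative_eq_intros)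
    have "\<forall>\<^sub>F y in at_top. - z - 2 * y \<le> Z" for Z
      by (rule eventually_mono[OF eventually_ge_at_top[of "\<bar>z\<bar> + \<bar>Z\<bar>"]]) auto
    then have "filterlim (\<lambda>y. - z - 2 * y) at_bot at_top"
      by (simp add: filterlim_at_bot)
    then have "((\<lambda>y. exp (- z - 2 * y)) \<longlongrightarrow> 0) at_top"
      by (rule filterlim_compose[OF exp_at_bot])
    then have "((\<lambda>y. - exp (- z - 2 * y) / 2) \<longlongrightarrow> - 0 / 2) at_top"
      by (intro tendsto_intros) auto
    then show "((\<lambda>y::real. - exp (- z - 2 * y) / 2) \<longlongrightarrow> 0) at_top" by simp
  qed auto
  also have "- z - 2 * a = - \<bar>z\<bar>" by (auto simp: a_def)
  finally show ?thesis by simp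
qed

text \<open>The translation \<open>x = z + y\<close> in the inner integral, followed by Fubini,
  leaves the convolution density.\<close>

lemma xi_eq_distr: "xi = distr (exp_measure \<Otimes>\<^sub>M exp_measure) borel (\<lambda>p. fst p - snd p)"
proof (rule measure_eqI)
  show "sets xi = sets (distr (exp_measure \<Otimes>\<^sub>M exp_measure) borel (\<lambda>p. fst p - snd p))" by simp
  fix A assume "A \<in> sets xi"
  then have [measurable]: "A \<in> sets borel" by simp
  let ?g = "\<lambda>x. ennreal (exponential_density 1 x)"
  interpret E: prob_space exp_measure by (rule prob_space_exponential_density) simp
  interpret P: pair_sigma_finite exp_measure exp_measure ..
  have "emeasure (distr (exp_measure \<Otimes>\<^sub>M exp_measure) borel (\<lambda>p. fst p - snd p)) A
      = (\<integral>\<^sup>+z. indicator A z \<partial>distr (exp_measure \<Otimes>\<^sub>M exp_measure) borel (\<lambda>p. fst p - snd p))"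
    by simp
  also have "\<dots> = (\<integral>\<^sup>+p. indicator A (fst p - snd p) \<partial>(exp_measure \<Otimes>\<^sub>M exp_measure))"
    by (rule nn_integral_distr) simp_all
  also have "\<dots> = (\<integral>\<^sup>+y. \<integral>\<^sup>+x. indicator A (x - y) \<partial>exp_measure \<partial>exp_measure)"
    by (subst P.nn_integral_snd[symmetric]) simp_all
  also have "\<dots> = (\<integral>\<^sup>+y. ?g y * (\<integral>\<^sup>+x. ?g x * indicator A (x - y) \<partial>lborel) \<partial>lborel)"
    by (simp add: nn_integral_density)
  also have "\<dots> = (\<integral>\<^sup>+y. ?g y * (\<integral>\<^sup>+z. ?g (z + y) * indicator A z \<partial>lborel) \<partial>lborel)"
  proof (rule nn_integral_cong)
    fix y :: real
    show "?g y * (\<integral>\<^sup>+x. ?g x * indicator A (x - y) \<partial>lborel)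
        = ?g y * (\<integral>\<^sup>+z. ?g (z + y) * indicator A z \<partial>lborel)"
      using nn_integral_real_affine[of "\<lambda>x. ?g x * indicator A (x - y)" 1 y]
      by (simp add: add.commute)
  qed
  also have "\<dots> = (\<integral>\<^sup>+y. \<integral>\<^sup>+z. indicator A z * (?g (z + y) * ?g y) \<partial>lborel \<partial>lborel)"
    by (simp add: nn_integral_cmult[symmetric] mult_ac)
  also have "\<dots> = (\<integral>\<^sup>+z. \<integral>\<^sup>+y. indicator A z * (?g (z + y) * ?g y) \<partial>lborel \<partial>lborel)"
    by (rule lborel_pair.Fubini') simp
  also have "\<dots> = (\<integral>\<^sup>+z. indicator A z * ennreal (exp (- \<bar>z\<bar>) / 2) \<partial>lborel)"
    by (simp add: nn_integral_cmult nn_integral_exponential_density_shift)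
  also have "\<dots> = (\<integral>\<^sup>+z. ennreal (exp (- \<bar>z\<bar>) / 2) * indicator A z \<partial>lborel)"
    by (simp add: mult.commute)
  also have "\<dots> = emeasure xi A"
    by (simp add: xi_def emeasure_density)
  finally show "emeasure xi A
      = emeasure (distr (exp_measure \<Otimes>\<^sub>M exp_measure) borel (\<lambda>p. fst p - snd p)) A" ..
qed

text \<open>The comparison of costs required for the difference map is
  \<open>maurey_cost_half_diff\<close>.\<close>

lemma property_tau_xi: "property_tau xi (\<lambda>x y. 2 * maurey_cost ((x - y) / 2))"
  unfolding xi_eq_distr
proof (rule property_tau_distr)
  interpret E: prob_space exp_measure by (rule prob_space_exponential_density) simp
  show "property_tau (exp_measure \<Otimes>\<^sub>M exp_measure)
      (\<lambda>p q. maurey_cost (fst p - fst q) + maurey_cost (snd p - snd q))"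
    by (rule property_tau_pair[OF _ property_tau_exp_measure property_tau_exp_measure]) unfold_locales
  show "2 * maurey_cost ((fst p - snd p - (fst q - snd q)) / 2) \<le> maurey_cost (fst p - fst q) + maurey_cost (snd p - snd q)"
    for p q :: "real \<times> real"
    using maurey_cost_half_diff[of "fst p - fst q" "snd p - snd q"] by (simp add: algebra_simps)
qed simp

lemma property_tau_xi_n:
  "property_tau (xi_n :: (real ^ 'n) measure) (\<lambda>x y. \<Sum>i\<in>UNIV. 2 * maurey_cost ((x - y) $ i / 2))"
  unfolding xi_n_def
  by (rule property_tau_distr[OF property_tau_PiM[OF finite prob_space_xi property_tau_xi]
        measurable_vec_lambda_PiM]) simp

section \<open>From the cost to the enlargement\<close>

lemma cost_le_imp_mem_sum:
  fixes x :: "real ^ 'n"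
  assumes le: "(\<Sum>i\<in>UNIV. 2 * maurey_cost (x $ i / 2)) \<le> t" and t: "0 < t"
  obtains b c where "b \<in> B2" "c \<in> B1" "x = (6 * sqrt t) *\<^sub>R b + (9 * t) *\<^sub>R c"
proof -
  \<comment> \<open>At 4 the argument \<open>x $ i / 2\<close> leaves the quadratic range. Below it
    the cost is \<open>(x $ i)\<^sup>2 / 36\<close>, giving the radius \<open>6 * sqrt t\<close>;
    above it the cost is at least \<open>\<bar>x $ i\<bar> / 9\<close>, giving
    \<open>9 * t\<close>.\<close>
  define y :: "real ^ 'n" where "y = (\<chi> i. if \<bar>x $ i\<bar> \<le> 4 then x $ i else 0)"
  have y: "(y $ i)\<^sup>2 / 36 \<le> 2 * maurey_cost (x $ i / 2)" for i
    by (simp add: y_def maurey_cost_def power_divide)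
  have xy: "\<bar>(x - y) $ i\<bar> / 9 \<le> 2 * maurey_cost (x $ i / 2)" for i
    by (simp add: y_def maurey_cost_def field_simps)
  have "(\<Sum>i\<in>UNIV. (y $ i)\<^sup>2 / 36) \<le> t"
    by (rule order_trans[OF sum_mono[OF y] le])
  then have "(1 / (6 * sqrt t)) *\<^sub>R y \<in> B2"
    using t by (simp add: B2_def power_divide power_mult_distrib field_simps flip: sum_divide_distrib)
  moreover have "(\<Sum>i\<in>UNIV. \<bar>(x - y) $ i\<bar> / 9) \<le> t"
    by (rule order_trans[OF sum_mono[OF xy] le])
  then have "(1 / (9 * t)) *\<^sub>R (x - y) \<in> B1"
    using t by (simp add: B1_def abs_mult field_simps flip: sum_divide_distrib)
  ultimately show thesis
    using t by (intro that[of "(1 / (6 * sqrt t)) *\<^sub>R y" "(1 / (9 * t)) *\<^sub>R (x - y)"]) simp_all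
qed

text \<open>Any pair from \<open>S\<close> and \<open>A\<close> has cost at least \<open>t\<close>,
  so \<open>exp t\<close> on \<open>S\<close> and 1 on \<open>A\<close> are admissible. The Borel
  set \<open>S\<close> stands in for the complement of the enlargement, which need not be
  Borel.\<close>

lemma xi_n_disjoint_enlargement_le:
  fixes A S :: "(real ^ 'n) set"
  assumes A [measurable]: "A \<in> sets borel" and S [measurable]: "S \<in> sets borel" and t: "0 < t"
    and disj: "S \<inter> (A + (\<lambda>y. (6 * sqrt t) *\<^sub>R y) ` B2 + (\<lambda>z. (9 * t) *\<^sub>R z) ` B1) = {}"
  shows "emeasure xi_n S \<le> inverse (emeasure xi_n A) * ennreal (exp (- t))"
proof -
  let ?w = "\<lambda>x y :: real ^ 'n. \<Sum>i\<in>UNIV. 2 * maurey_cost ((x - y) $ i / 2)"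
  have "(\<integral>\<^sup>+x. ennreal (exp t) * indicator S x \<partial>xi_n) * (\<integral>\<^sup>+x. indicator A x \<partial>xi_n) \<le> 1"
  proof (rule property_tauD[OF property_tau_xi_n])
    fix x y :: "real ^ 'n"
    have "t \<le> ?w x y" if "x \<in> S" "y \<in> A"
    proof (rule ccontr)
      assume "\<not> t \<le> ?w x y"
      then obtain b c where "b \<in> B2" "c \<in> B1" "x - y = (6 * sqrt t) *\<^sub>R b + (9 * t) *\<^sub>R c"
        using cost_le_imp_mem_sum[of "x - y" t] t by auto
      moreover from this have "x = y + (6 * sqrt t) *\<^sub>R b + (9 * t) *\<^sub>R c"
        by (simp add: algebra_simps)
      ultimately show False
        using disj that by (blast intro: set_plus_intro)
    qed
    then show "ennreal (exp t) * indicator S x * indicator A y \<le> ennreal (exp (?w x y))"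
      by (auto split: split_indicator intro: ennreal_leI)
  qed simp_all
  then have *: "ennreal (exp t) * emeasure xi_n S * emeasure xi_n A \<le> 1"
    by (simp add: nn_integral_cmult)
  interpret prob_space "xi_n :: (real ^ 'n) measure" by (rule prob_space_xi_n)
  show ?thesis
  proof (cases "emeasure xi_n A = 0")
    case True
    then show ?thesis by (simp add: ennreal_top_mult)
  next
    case False
    have "emeasure xi_n S = (ennreal (exp t) * emeasure xi_n S * emeasure xi_n A)
        * (inverse (emeasure xi_n A) * ennreal (exp (- t)))"
    proof -
      have "emeasure xi_n A * inverse (emeasure xi_n A) = 1"
        using ennreal_divide_self[OF False] by (simp add: divide_ennreal_def less_top[symmetric])
      moreover have "ennreal (exp t) * ennreal (exp (- t)) = 1"
        by (simp flip: ennreal_mult exp_add)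
      ultimately show ?thesis
        by (metis (no_types, lifting) mult.assoc mult.commute mult.right_neutral)
    qed
    also have "\<dots> \<le> 1 * (inverse (emeasure xi_n A) * ennreal (exp (- t)))"
      by (rule mult_right_mono[OF *]) simp
    finally show ?thesis by simp
  qed
qed

section \<open>Measurability of the enlargement\<close>

text \<open>Fubini with coordinate \<open>i\<close> integrated first: \<open>xi\<close> has a
  density, so countable sections contribute 0.\<close>

lemma null_sets_xi_n_if_countable_sections:
  fixes B :: "(real ^ 'n) set"
  assumes B [measurable]: "B \<in> sets borel"
    and count: "\<And>x. countable {s. x + s *\<^sub>R axis i 1 \<in> B}"
  shows "B \<in> null_sets xi_n"
proof -
  interpret P: product_prob_space "\<lambda>_. xi" "UNIV :: 'n set"
    by (rule product_prob_space_xi)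
  let ?v = "\<lambda>f. (\<chi> j. f j) :: real ^ 'n"
  have ins: "insert i (UNIV - {i}) = (UNIV :: 'n set)" by auto
  note [measurable] = measurable_vec_lambda_PiM
  have "emeasure xi_n B = (\<integral>\<^sup>+f. indicator B (?v f) \<partial>(\<Pi>\<^sub>M i\<in>(UNIV :: 'n set). xi))"
  proof -
    have "emeasure xi_n B = (\<integral>\<^sup>+x. indicator B x \<partial>xi_n)" by simp
    also have "\<dots> = (\<integral>\<^sup>+f. indicator B (?v f) \<partial>(\<Pi>\<^sub>M i\<in>(UNIV :: 'n set). xi))"
      unfolding xi_n_def by (rule nn_integral_distr) simp_all
    finally show ?thesis .
  qed
  also have "\<dots> = (\<integral>\<^sup>+f. \<integral>\<^sup>+y. indicator B (?v (f(i := y))) \<partial>xi \<partial>(\<Pi>\<^sub>M i\<in>(UNIV - {i} :: 'n set). xi))"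
    using P.product_nn_integral_insert[of "UNIV - {i}" i "\<lambda>f. indicator B (?v f)"]
    unfolding ins by simp
  also have "\<dots> = (\<integral>\<^sup>+f. 0 \<partial>(\<Pi>\<^sub>M i\<in>(UNIV - {i} :: 'n set). xi))"
  proof (rule nn_integral_cong)
    fix f :: "'n \<Rightarrow> real"
    let ?S = "{s. ?v (f(i := 0)) + s *\<^sub>R axis i 1 \<in> B}"
    have v: "?v (f(i := y)) = ?v (f(i := 0)) + y *\<^sub>R axis i 1" for y
      by (simp add: vec_eq_iff axis_def)
    have "(\<integral>\<^sup>+y. ennreal (exp (- \<bar>y\<bar>) / 2) * indicator ?S y \<partial>lborel) = 0"
      by (rule nn_integral_null_set[OF countable_imp_null_set_lborel[OF count]])
    moreover have "(\<integral>\<^sup>+y. indicator ?S y \<partial>xi) = (\<integral>\<^sup>+y. ennreal (exp (- \<bar>y\<bar>) / 2) * indicator ?S y \<partial>lborel)"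
      unfolding xi_def by (rule nn_integral_density) (auto simp: sets.countable[OF _ count])
    moreover have "indicator B (?v (f(i := y))) = (indicator ?S y :: ennreal)" for y
      by (subst v) (simp only: indicator_def mem_Collect_eq)
    ultimately show "(\<integral>\<^sup>+y. indicator B (?v (f(i := y))) \<partial>xi) = 0" by (simp only:)
  qed
  finally show ?thesis by (auto simp: null_sets_def)
qed

text \<open>\<open>N\<close> is covered by the countably many sets \<open>P i \<sigma> m\<close> of
  points with a gap of fixed length on one side in direction \<open>i\<close>. On each line in that
  direction such points are uniformly separated, hence countable.\<close>

lemma null_sets_xi_n_if_one_sided_isolated:
  fixes N :: "(real ^ 'n) set"
  assumes N: "closed N"
    and iso: "\<And>x. x \<in> N \<Longrightarrow> \<exists>i. \<exists>\<sigma>\<in>{1, - 1}. \<exists>r>0. \<forall>s. 0 < s \<and> s < r \<longrightarrow> x + (s * \<sigma>) *\<^sub>R axis i 1 \<notin> N"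
  shows "N \<in> null_sets xi_n"
proof -
  define P where "P i \<sigma> m = {x \<in> N. \<forall>s. 0 < s \<and> s \<le> inverse (real (Suc m)) \<longrightarrow> x + (s * \<sigma>) *\<^sub>R axis i 1 \<notin> N}"
    for i :: 'n and \<sigma> :: real and m :: nat
  have "P i \<sigma> m \<in> null_sets xi_n" if \<sigma>: "\<sigma> \<in> {1, - 1}" for i \<sigma> m
  proof (rule null_sets_xi_n_if_countable_sections)
    \<comment> \<open>For measurability, the open condition \<open>0 < s\<close> is exhausted by
      compact ranges of \<open>s\<close>; each makes the excluded set a sum of a closed and a
      compact set.\<close>
    let ?C = "\<lambda>k. (\<lambda>s. - (s * \<sigma>) *\<^sub>R axis i 1 :: real ^ 'n) ` {inverse (real (Suc k))..inverse (real (Suc m))}"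
    have "P i \<sigma> m = N - (\<Union>k. \<Union>x\<in>N. \<Union>c\<in>?C k. {x + c})"
    proof -
      have "x \<in> (\<Union>k. \<Union>x\<in>N. \<Union>c\<in>?C k. {x + c}) \<longleftrightarrow>
        (\<exists>s. 0 < s \<and> s \<le> inverse (real (Suc m)) \<and> x + (s * \<sigma>) *\<^sub>R axis i 1 \<in> N)" for x
      proof
        assume "x \<in> (\<Union>k. \<Union>x\<in>N. \<Union>c\<in>?C k. {x + c})"
        then obtain k y s where "y \<in> N" "inverse (real (Suc k)) \<le> s" "s \<le> inverse (real (Suc m))"
          "x = y + - (s * \<sigma>) *\<^sub>R axis i 1" by auto
        moreover have "0 < inverse (real (Suc k))" by simp
        ultimately show "\<exists>s. 0 < s \<and> s \<le> inverse (real (Suc m)) \<and> x + (s * \<sigma>) *\<^sub>R axis i 1 \<in> N"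
          by (intro exI[of _ s] conjI) (linarith | simp)+
      next
        assume "\<exists>s. 0 < s \<and> s \<le> inverse (real (Suc m)) \<and> x + (s * \<sigma>) *\<^sub>R axis i 1 \<in> N"
        then obtain s where s: "0 < s" "s \<le> inverse (real (Suc m))" "x + (s * \<sigma>) *\<^sub>R axis i 1 \<in> N" by blast
        obtain k where "inverse (real (Suc k)) < s" using reals_Archimedean[OF s(1)] by blast
        with s(2) have "- (s * \<sigma>) *\<^sub>R axis i 1 \<in> ?C k" by auto
        moreover have "x = (x + (s * \<sigma>) *\<^sub>R axis i 1) + - (s * \<sigma>) *\<^sub>R axis i 1" by simp
        ultimately show "x \<in> (\<Union>k. \<Union>x\<in>N. \<Union>c\<in>?C k. {x + c})" using s(3) by blast
      qed
      then show ?thesis unfolding P_def by blast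
    qed
    moreover have "closed (\<Union>x\<in>N. \<Union>c\<in>?C k. {x + c})" for k
      by (intro closed_compact_sums N compact_continuous_image continuous_intros) auto
    ultimately show "P i \<sigma> m \<in> sets borel"
      using N by (auto intro!: sets.Diff sets.countable_UN borel_closed)
    fix x
    let ?S = "{s. x + s *\<^sub>R axis i 1 \<in> P i \<sigma> m}"
    have gap: False if "s \<in> ?S" "s' \<in> ?S" "s < s'" "\<lfloor>s * real (Suc m)\<rfloor> = \<lfloor>s' * real (Suc m)\<rfloor>" for s s'
    proof -
      have "s' * real (Suc m) - s * real (Suc m) < 1" using that(4) by linarith
      then have le: "s' - s \<le> inverse (real (Suc m))" by (simp add: field_simps)
      have mem: "x + s *\<^sub>R axis i 1 \<in> N" "x + s' *\<^sub>R axis i 1 \<in> N"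
        using that by (auto simp: P_def)
      have "x + s *\<^sub>R axis i 1 + ((s' - s) * \<sigma>) *\<^sub>R axis i 1 \<notin> N"
        "x + s' *\<^sub>R axis i 1 + ((s' - s) * \<sigma>) *\<^sub>R axis i 1 \<notin> N"
        using that(1,2,3) le by (auto simp: P_def)
      \<comment> \<open>For \<open>\<sigma> = 1\<close> the step from \<open>s\<close> lands on
        \<open>s'\<close>; for \<open>\<sigma> = - 1\<close> the step from \<open>s'\<close> lands
        on \<open>s\<close>.\<close>
      with mem \<sigma> show False by (auto simp: algebra_simps)
    qed
    have "inj_on (\<lambda>s. \<lfloor>s * real (Suc m)\<rfloor>) ?S"
    proof (rule inj_onI)
      show "s = s'" if "s \<in> ?S" "s' \<in> ?S" "\<lfloor>s * real (Suc m)\<rfloor> = \<lfloor>s' * real (Suc m)\<rfloor>" for s s'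
        using gap[of s s'] gap[of s' s] that by (cases s s' rule: linorder_cases) auto
    qed
    then show "countable ?S" by (rule countableI')
  qed
  then have "(\<Union>i. \<Union>\<sigma>\<in>{1, - 1}. \<Union>m. P i \<sigma> m) \<in> null_sets xi_n"
    by (intro null_sets_UN' countable_finite[OF finite] countableI_type) simp_all
  moreover have "N \<subseteq> (\<Union>i. \<Union>\<sigma>\<in>{1, - 1}. \<Union>m. P i \<sigma> m)"
  proof
    fix x assume x: "x \<in> N"
    obtain i \<sigma> r where r: "\<sigma> \<in> {1, - 1}" "r > 0"
      and *: "\<And>s. 0 < s \<Longrightarrow> s < r \<Longrightarrow> x + (s * \<sigma>) *\<^sub>R axis i 1 \<notin> N"
      using iso[OF x] by blast
    obtain m where "inverse (real (Suc m)) < r" using reals_Archimedean[OF r(2)] by blast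
    then have "x \<in> P i \<sigma> m" using x * by (auto simp: P_def)
    with r(1) show "x \<in> (\<Union>i. \<Union>\<sigma>\<in>{1, - 1}. \<Union>m. P i \<sigma> m)" by blast
  qed
  ultimately show ?thesis
    using N by (auto intro: null_sets_subset)
qed

section \<open>The boundary of the enlargement\<close>

text \<open>Moving a nonzero coordinate towards 0 without reaching it brings a point of either
  closed ball into its open counterpart.\<close>

lemma shrink_coordinate:
  fixes x :: "real ^ 'n"
  assumes s: "0 < s" "s < \<bar>x $ i\<bar>"
  defines "y \<equiv> x + (s * - sgn (x $ i)) *\<^sub>R axis i 1"
  shows "(\<Sum>j\<in>UNIV. \<bar>y $ j\<bar>) < (\<Sum>j\<in>UNIV. \<bar>x $ j\<bar>)" and "norm y < norm x"
proof -
  have le: "\<bar>y $ j\<bar> \<le> \<bar>x $ j\<bar>" for j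
    using s by (cases "j = i") (auto simp: y_def axis_def sgn_if)
  have less: "\<bar>y $ i\<bar> < \<bar>x $ i\<bar>"
    using s by (auto simp: y_def axis_def sgn_if)
  show "(\<Sum>j\<in>UNIV. \<bar>y $ j\<bar>) < (\<Sum>j\<in>UNIV. \<bar>x $ j\<bar>)"
    using le less by (intro sum_strict_mono_ex1) auto
  have "(\<Sum>j\<in>UNIV. (y $ j)\<^sup>2) < (\<Sum>j\<in>UNIV. (x $ j)\<^sup>2)"
  proof (rule sum_strict_mono_ex1)
    show "\<forall>j\<in>UNIV. (y $ j)\<^sup>2 \<le> (x $ j)\<^sup>2"
      using le by (simp flip: abs_le_square_iff)
    show "\<exists>j\<in>UNIV. (y $ j)\<^sup>2 < (x $ j)\<^sup>2"
      using less by (intro bexI[of _ i]) (simp_all add: not_le[symmetric] flip: abs_le_square_iff)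
  qed simp
  then show "norm y < norm x"
    by (simp add: norm_vec_def L2_set_def)
qed

lemma scaled_B2: "0 < a \<Longrightarrow> (\<lambda>y. a *\<^sub>R y) ` B2 = cball (0 :: real ^ 'n) a"
proof -
  assume a: "0 < a"
  have "B2 = cball (0 :: real ^ 'n) 1"
    by (auto simp: B2_def norm_vec_def L2_set_def)
  then show ?thesis using a cball_scale[of a "0 :: real ^ 'n" 1] by simp
qed

lemma scaled_B1: "0 < a \<Longrightarrow> (\<lambda>y. a *\<^sub>R y) ` B1 = {x :: real ^ 'n. (\<Sum>i\<in>UNIV. \<bar>x $ i\<bar>) \<le> a}"
proof (intro equalityI subsetI)
  fix x :: "real ^ 'n" assume a: "0 < a"
  {
    assume "x \<in> (\<lambda>y. a *\<^sub>R y) ` B1"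
    with a show "x \<in> {x. (\<Sum>i\<in>UNIV. \<bar>x $ i\<bar>) \<le> a}"
      by (auto simp: B1_def abs_mult simp flip: sum_distrib_left)
  next
    assume "x \<in> {x. (\<Sum>i\<in>UNIV. \<bar>x $ i\<bar>) \<le> a}"
    with a have "inverse a *\<^sub>R x \<in> B1"
      by (simp add: B1_def abs_mult field_simps flip: sum_divide_distrib)
    with a show "x \<in> (\<lambda>y. a *\<^sub>R y) ` B1"
      by (intro image_eqI[of _ _ "inverse a *\<^sub>R x"]) simp_all
  }
qed

lemma set_plus_eq_UN: "A + B = (\<Union>x\<in>A. \<Union>y\<in>B. {x + y})" for A B :: "'a::plus set"
  by (auto simp: set_plus_def)

text \<open>The open set of all \<open>w\<close> with \<open>x - w\<close> in \<open>V\<close>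
  contains \<open>a\<close>, hence meets \<open>A\<close>.\<close>

lemma closure_plus_open_subset:
  fixes A V :: "'a::real_normed_vector set"
  assumes "open V" shows "closure A + V \<subseteq> A + V"
proof
  fix x assume "x \<in> closure A + V"
  then obtain a v where av: "a \<in> closure A" "v \<in> V" "x = a + v" by (auto simp: set_plus_def)
  have "open ((\<lambda>w. x - w) -` V)"
    by (intro open_vimage assms continuous_intros)
  moreover have "a \<in> (\<lambda>w. x - w) -` V" using av by simp
  ultimately obtain w where "w \<in> A" "x - w \<in> V"
    using av(1) open_Int_closure_eq_empty[of "(\<lambda>w. x - w) -` V" A] by auto
  then show "x \<in> A + V" using set_plus_intro[of w A "x - w" V] by simp
qed

text \<open>In \<open>G\<close> one of the two ball summands is strictly interior, while
  \<open>D\<close> uses the closure of \<open>A\<close> and both closed balls. A point of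
  \<open>D - G\<close> enters \<open>G\<close> when a nonzero coordinate of a ball summand shrinks,
  so \<open>D - G\<close> is isolated on one side.\<close>

lemma enlargement_sandwich:
  fixes A :: "(real ^ 'n) set"
  assumes \<alpha>: "0 < \<alpha>" and \<beta>: "0 < \<beta>"
  defines "K \<equiv> A + (\<lambda>y. \<alpha> *\<^sub>R y) ` B2 + (\<lambda>z. \<beta> *\<^sub>R z) ` B1"
  obtains D G where "closed D" "open G" "G \<subseteq> K" "K \<subseteq> D" "D - G \<in> null_sets xi_n"
proof -
  let ?l1 = "\<lambda>x :: real ^ 'n. \<Sum>i\<in>UNIV. \<bar>x $ i\<bar>"
  let ?K2 = "cball (0 :: real ^ 'n) \<alpha>" and ?K1 = "{x. ?l1 x \<le> \<beta>}"
  let ?U2 = "ball (0 :: real ^ 'n) \<alpha>" and ?U1 = "{x. ?l1 x < \<beta>}"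
  define V where "V = (?K2 + ?U1) \<union> (?U2 + ?K1)"
  define D where "D = closure A + (?K2 + ?K1)"
  define G where "G = A + V"
  have U1: "open ?U1" by (intro open_Collect_less continuous_intros)
  have "closed ?K1" by (intro closed_Collect_le continuous_intros)
  moreover have "?K1 \<subseteq> cball 0 \<beta>" using order_trans[OF norm_le_l1_cart] by auto
  ultimately have K1: "compact ?K1"
    by (meson bounded_cball bounded_subset compact_eq_bounded_closed)
  have V: "open V"
    unfolding V_def set_plus_eq_UN using U1 by (intro open_Un open_sums) auto
  have KK: "compact (?K2 + ?K1)"
    unfolding set_plus_eq_UN by (rule compact_sums') (use K1 in auto)
  have D: "closed D"
    unfolding D_def by (subst set_plus_eq_UN) (intro closed_compact_sums KK closed_closure)
  have G: "open G" 
    unfolding G_def by (subst set_plus_eq_UN) (intro open_sums disjI2 V)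
  have K: "K = A + (?K2 + ?K1)"
    unfolding K_def scaled_B2[OF \<alpha>] scaled_B1[OF \<beta>] by (simp add: add.assoc)
  have "V \<subseteq> ?K2 + ?K1"
    unfolding V_def by (intro Un_least set_plus_mono2) auto
  then have "G \<subseteq> K" unfolding G_def K by (intro set_plus_mono2) auto
  moreover have "K \<subseteq> D" unfolding D_def K by (intro set_plus_mono2 closure_subset) auto
  moreover have "D - G \<in> null_sets xi_n"
  proof (rule null_sets_xi_n_if_one_sided_isolated)
    show "closed (D - G)" using D G by (rule closed_Diff)
    fix x assume x: "x \<in> D - G"
    then obtain a b c where abc: "a \<in> closure A" "b \<in> ?K2" "c \<in> ?K1" "x = a + (b + c)"
      unfolding D_def by (auto elim!: set_plus_elim)
    \<comment> \<open>Since \<open>V\<close> is open, base points in the closure of \<open>A\<close>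
      are as good as points of \<open>A\<close>.\<close>
    have in_G: "a + v \<in> G" if "v \<in> V" for v
      using closure_plus_open_subset[OF V, of A] abc(1) that unfolding G_def by (auto intro: set_plus_intro)
    \<comment> \<open>If both vanished, \<open>x = a\<close> would already lie in \<open>G\<close>,
      because 0 belongs to \<open>V\<close>.\<close>
    have "b \<noteq> 0 \<or> c \<noteq> 0"
    proof (rule ccontr)
      assume "\<not> (b \<noteq> 0 \<or> c \<noteq> 0)"
      moreover have "0 + 0 \<in> ?U2 + ?K1" using \<alpha> \<beta> by (intro set_plus_intro) auto
      ultimately show False using in_G[of 0] x abc by (auto simp: V_def)
    qed
    then show "\<exists>i. \<exists>\<sigma>\<in>{1, - 1}. \<exists>r>0. \<forall>s. 0 < s \<and> s < r \<longrightarrow> x + (s * \<sigma>) *\<^sub>R axis i 1 \<notin> D - G"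
    proof
      assume "c \<noteq> 0"
      then obtain i where i: "c $ i \<noteq> 0" by (auto simp: vec_eq_iff)
      have "x + (s * - sgn (c $ i)) *\<^sub>R axis i 1 \<in> G" if "0 < s" "s < \<bar>c $ i\<bar>" for s
      proof -
        have "b + (c + (s * - sgn (c $ i)) *\<^sub>R axis i 1) \<in> V"
          unfolding V_def using shrink_coordinate(1)[OF that] abc
          by (intro UnI1 set_plus_intro) auto
        from in_G[OF this] show ?thesis by (simp only: abc(4) add.assoc)
      qed
      then show ?thesis using i
        by (intro exI[of _ i] bexI[of _ "- sgn (c $ i)"] exI[of _ "\<bar>c $ i\<bar>"]) (auto simp: sgn_if)
    next
      assume "b \<noteq> 0"
      then obtain i where i: "b $ i \<noteq> 0" by (auto simp: vec_eq_iff)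
      have "x + (s * - sgn (b $ i)) *\<^sub>R axis i 1 \<in> G" if "0 < s" "s < \<bar>b $ i\<bar>" for s
      proof -
        have "(b + (s * - sgn (b $ i)) *\<^sub>R axis i 1) + c \<in> V"
          unfolding V_def using shrink_coordinate(2)[OF that] abc
          by (intro UnI2 set_plus_intro) auto
        from in_G[OF this] show ?thesis by (simp only: abc(4) add_ac)
      qed
      then show ?thesis using i
        by (intro exI[of _ i] bexI[of _ "- sgn (b $ i)"] exI[of _ "\<bar>b $ i\<bar>"]) (auto simp: sgn_if)
    qed
  qed
  ultimately show thesis using that D G by blast
qed

theorem corollary1:
  fixes A :: "(real ^ 'n) set" and t :: real
  assumes "A \<in> sets borel" and "t > 0"
  shows "let E = {x. x \<notin> A + (\<lambda>y. (6 * sqrt t) *\<^sub>R y) ` B2 + (\<lambda>z. (9 * t) *\<^sub>R z) ` B1}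
    in E \<in> sets (completion xi_n)
      \<and> emeasure (completion xi_n) E \<le> inverse (emeasure xi_n A) * ennreal (exp (- t))"
proof -
  let ?K = "A + (\<lambda>y. (6 * sqrt t) *\<^sub>R y) ` B2 + (\<lambda>z. (9 * t) *\<^sub>R z) ` B1"
  define E where "E = {x. x \<notin> ?K}"
  have "0 < 6 * sqrt t" "0 < 9 * t" using assms by simp_all
  then obtain D G where DG: "closed D" "open G" "G \<subseteq> ?K" "?K \<subseteq> D" "D - G \<in> null_sets xi_n"
    by (rule enlargement_sandwich)
  \<comment> \<open>A Borel set together with a subset of a null set, hence measurable in the
    completion.\<close>
  have "E = - D \<union> (E \<inter> (D - G))" using DG(3,4) by (auto simp: E_def)
  moreover have "- D \<in> sets xi_n" using DG(1) by simp
  ultimately have E: "E \<in> sets (completion xi_n)"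
    by (intro sets_completionI[OF _ Int_lower2 DG(5)])
  \<comment> \<open>The main part is a Borel subset of \<open>E\<close> carrying its completed
    measure, so the Borel estimate applies to it.\<close>
  have "emeasure xi_n (main_part xi_n E) \<le> inverse (emeasure xi_n A) * ennreal (exp (- t))"
  proof (rule xi_n_disjoint_enlargement_le)
    show "main_part xi_n E \<in> sets borel" using main_part_sets[OF E] by simp
    have "main_part xi_n E \<subseteq> E" using main_part_null_part_Un[OF E] by blast
    then show "main_part xi_n E \<inter> ?K = {}" by (auto simp: E_def)
  qed (fact assms)+
  with E show ?thesis by (simp add: E_def Let_def)
qed

end
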